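(* Let $n\ge r\ge 1$ be integers and let $G=V^1\vee V^2\vee\cdots\vee V^r$ be a join digraph of order $n$, where each $V^i$ is a weakly connected acyclic digraph on $n_i$ vertices, $n_1\ge n_2\ge\cdots\ge n_r\ge 1$ and $\sum_{i=1}^r n_i=n$. Then $$LE(G)\geq (r-1)n^2+r^2n-r^3,$$ with equality if and only if each $V^i$ is an in-tree, $n_1=n-r+1$, and $n_2=\cdots=n_r=1$.
   Context: All digraphs are finite, have no loops or multiple arcs, and are weakly connected (standing assumption). For a digraph $G$ with vertex set $\{v_1,\dots,v_n\}$, $d_i^+$ is the outdegree of $v_i$, $A(G)$ is the adjacency matrix (entry $(i,j)$ is $1$ iff $(v_i,v_j)$ is an arc, else $0$), $D^+(G)=\mathrm{diag}(d_1^+,\dots,d_n^+)$, and the Laplacian matrix is $L(G)=D^+(G)-A(G)$. The Laplacian energy is $LE(G)=\sum_{i=1}^n\lambda_i^2$, where $\lambda_1,\dots,\lambda_n$ are the eigenvalues of $L(G)$ (with multiplicity). A digraph is acyclic if it has no directed cycle. The join $G_1\vee G_2$ of two vertex-disjoint digraphs has vertex set $\mathcal V(G_1)\cup\mathcal V(G_2)$ and arc set $\mathcal A(G_1)\cup\mathcal A(G_2)\cup\{(u,v),(v,u): u\in\mathcal V(G_1), v\in\mathcal V(G_2)\}$. An in-tree is a digraph whose underlying undirected graph is a tree and in which every vertex has outdegree at most one (a single vertex is an in-tree). *)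

theory Defs
  imports
    "Graph_Theory.Digraph_Component"
    "Jordan_Normal_Form.Char_Poly"
begin

text \<open>
  Digraphs are values of type \<open>'a pair_pre_digraph\<close>, whose arcs are ordered pairs, so there are no
  multiple arcs; the locale \<^locale>\<open>pair_digraph\<close> adds finiteness and the absence of loops.
  Weak connectedness is \<^const>\<open>Digraph_Component.connected\<close>.
\<close>

definition digraph_acyclic :: "'a pair_pre_digraph \<Rightarrow> bool" where
  "digraph_acyclic G \<longleftrightarrow> \<not> (\<exists>p. pre_digraph.cycle (with_proj G) p)"

text \<open>
  The library represents an undirected graph as a symmetric digraph, in which every edge
  gives rise to a directed cycle of length two. These are not cycles of the undirected graph, so
  the library predicates \<^const>\<open>forest\<close> and \<^const>\<open>tree\<close> do not express
  that the underlying undirected graph is a forest or a tree.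
\<close>

definition underlying_tree :: "'a pair_pre_digraph \<Rightarrow> bool" where
  "underlying_tree G \<longleftrightarrow> Digraph_Component.connected (with_proj G) \<and>
     \<not> (\<exists>p. pre_digraph.cycle (with_proj (mk_symmetric (with_proj G))) p \<and> 3 \<le> length p)"

definition in_tree :: "'a pair_pre_digraph \<Rightarrow> bool" where
  "in_tree G \<longleftrightarrow> underlying_tree G \<and> (\<forall>v\<in>pverts G. out_degree (with_proj G) v \<le> 1)"

definition digraph_join :: "'a pair_pre_digraph \<Rightarrow> 'a pair_pre_digraph \<Rightarrow> 'a pair_pre_digraph" where
  "digraph_join G H = \<lparr> pverts = pverts G \<union> pverts H,
     parcs = parcs G \<union> parcs H \<union> pverts G \<times> pverts H \<union> pverts H \<times> pverts G \<rparr>"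

text \<open>The join of \<open>V 1, \<dots>, V r\<close>, for \<open>r \<ge> 1\<close>, bracketed to the left.\<close>

definition iterated_join :: "(nat \<Rightarrow> 'a pair_pre_digraph) \<Rightarrow> nat \<Rightarrow> 'a pair_pre_digraph" where
  "iterated_join V r = foldl digraph_join (V 1) (map V [2..<Suc r])"

text \<open>
  The matrices of \<open>G\<close> depend on an enumeration \<open>vs\<close> of its vertices, that is, a list with
  \<open>distinct vs\<close> and \<open>set vs = pverts G\<close>. Its positions are numbered from \<open>0\<close>.
\<close>

definition adjacency_mat :: "'a list \<Rightarrow> 'a pair_pre_digraph \<Rightarrow> complex mat" where
  "adjacency_mat vs G = mat (length vs) (length vs)
     (\<lambda>(i, j). if (vs ! i, vs ! j) \<in> parcs G then 1 else 0)"

definition out_degree_mat :: "'a list \<Rightarrow> 'a pair_pre_digraph \<Rightarrow> complex mat" where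
  "out_degree_mat vs G = mat (length vs) (length vs)
     (\<lambda>(i, j). if i = j then of_nat (out_degree (with_proj G) (vs ! i)) else 0)"

definition laplacian_mat :: "'a list \<Rightarrow> 'a pair_pre_digraph \<Rightarrow> complex mat" where
  "laplacian_mat vs G = out_degree_mat vs G - adjacency_mat vs G"

text \<open>The eigenvalues with algebraic multiplicity are the roots of the characteristic polynomial.\<close>

definition laplacian_energy :: "'a list \<Rightarrow> 'a pair_pre_digraph \<Rightarrow> complex" where
  "laplacian_energy vs G = (\<Sum>x\<in>#proots (char_poly (laplacian_mat vs G)). x\<^sup>2)"

end

theory Submission
  imports Defs "Jordan_Normal_Form.Schur_Decomposition"
begin

text \<open>
  The energy is the trace of \<open>L\<^sup>2\<close>, hence the sum of the squared outdegrees plus the number of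
  ordered pairs of opposite arcs. In the join the latter arise only between different factors, and
  a vertex of the factor of order \<open>n\<^sub>i\<close> gains outdegree \<open>n - n\<^sub>i\<close>. A connected factor has at least
  \<open>n\<^sub>i - 1\<close> arcs and at least as large a sum of squared outdegrees; the latter equals \<open>n\<^sub>i - 1\<close>
  exactly for in-trees. What remains is an inequality in \<open>x\<^sub>i = n\<^sub>i - 1\<close>, which holds because
  \<open>x (2 n - x)\<close> increases on \<open>[0, n]\<close>, so that \<open>\<Sum>x\<^sub>i\<^sup>2 (2 n - x\<^sub>i)\<close> is largest when one \<open>x\<^sub>i\<close> carries
  the whole sum.
\<close>

section \<open>Traces, eigenvalues and the sum of squared eigenvalues\<close>

definition mat_trace :: "'a::comm_monoid_add mat \<Rightarrow> 'a" where
  "mat_trace A = (\<Sum>i<dim_row A. A $$ (i, i))"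

lemma mat_trace_mult:
  assumes "A \<in> carrier_mat n m" "B \<in> carrier_mat m n"
  shows "mat_trace (A * B) = (\<Sum>i<n. \<Sum>j<m. A $$ (i, j) * B $$ (j, i))"
  using assms by (auto simp: mat_trace_def scalar_prod_def atLeast0LessThan intro!: sum.cong)

lemma mat_trace_mult_commute:
  fixes A B :: "'a::comm_semiring_0 mat"
  assumes "A \<in> carrier_mat n m" "B \<in> carrier_mat m n"
  shows "mat_trace (A * B) = mat_trace (B * A)"
  unfolding mat_trace_mult[OF assms] mat_trace_mult[OF assms(2,1)]
  by (subst sum.swap) (simp add: mult.commute)

text \<open>By cyclicity the factor \<open>P\<close> of \<open>P * (B * Q)\<close> moves to the end,
  where \<open>Q * P\<close> is the identity.\<close>

lemma mat_trace_similar: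
  fixes A B :: "'a::comm_ring_1 mat"
  assumes "similar_mat A B"
  shows "mat_trace A = mat_trace B"
proof -
  obtain P Q where wit: "similar_mat_wit A B P Q"
    using assms unfolding similar_mat_def by blast
  define n where "n = dim_row A"
  note w = similar_mat_witD[OF n_def wit]
  have "mat_trace A = mat_trace (P * (B * Q))"
    using w by (metis assoc_mult_mat)
  also have "\<dots> = mat_trace (B * Q * P)"
    using w by (intro mat_trace_mult_commute) auto
  also have "B * Q * P = B"
    using w by (metis assoc_mult_mat right_mult_one_mat)
  finally show ?thesis .
qed

text \<open>In the sum for the entry, a term with \<open>j < i\<close> has its first factor below
  the diagonal and a term with \<open>i < j\<close> its second, so only \<open>j = i\<close>
  survives.\<close>

lemma upper_triangular_square_diag:
  fixes A :: "'a::semiring_1 mat"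
  assumes A: "A \<in> carrier_mat n n" and "upper_triangular A" and i: "i < n"
  shows "(A * A) $$ (i, i) = (A $$ (i, i))\<^sup>2"
proof -
  have "(A * A) $$ (i, i) = (\<Sum>j<n. A $$ (i, j) * A $$ (j, i))"
    using A i by (auto simp: scalar_prod_def atLeast0LessThan)
  also have "\<dots> = (\<Sum>j<n. if j = i then (A $$ (i, i))\<^sup>2 else 0)"
  proof (intro sum.cong refl)
    fix j assume "j \<in> {..<n}"
    then have "j < i \<Longrightarrow> A $$ (i, j) = 0" "i < j \<Longrightarrow> A $$ (j, i) = 0"
      using upper_triangularD[OF assms(2)] A i by auto
    then show "A $$ (i, j) * A $$ (j, i) = (if j = i then (A $$ (i, i))\<^sup>2 else 0)"
      by (cases i j rule: linorder_cases) (auto simp: power2_eq_square)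
  qed
  finally show ?thesis using i by simp
qed

text \<open>A Schur form \<open>B\<close> is triangular and similar to \<open>A\<close>: its
  diagonal lists the eigenvalues with multiplicity, that of \<open>B * B\<close> lists their
  squares, and similarity preserves the trace.\<close>

lemma sum_mset_proots_char_poly_square:
  fixes A :: "complex mat"
  assumes A: "A \<in> carrier_mat n n"
  shows "(\<Sum>x\<in>#proots (char_poly A). x\<^sup>2) = mat_trace (A * A)"
proof -
  \<comment> \<open>Over the complex numbers the characteristic polynomial splits, as the Schur
    decomposition requires.\<close>
  obtain as where "char_poly A = (\<Prod>a\<leftarrow>as. [:- a, 1:])"
    using char_poly_factorized[OF A] by blast
  then obtain B where B: "B \<in> carrier_mat n n" "upper_triangular B" and sim: "similar_mat A B"
    using schur_decomposition_exists[OF A] by blast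
  have "char_poly A = (\<Prod>a\<leftarrow>diag_mat B. [:- a, 1:])"
    using char_poly_similar[OF sim] char_poly_upper_triangular[OF B] by simp
  moreover have "proots (\<Prod>a\<leftarrow>xs. [:- a, 1:]) = mset xs" for xs :: "complex list"
    by (induction xs) (simp_all add: proots_mult image_iff del: mult_pCons_left)
  ultimately have "proots (char_poly A) = mset (diag_mat B)"
    by simp
  then have "(\<Sum>x\<in>#proots (char_poly A). x\<^sup>2) = (\<Sum>x\<leftarrow>diag_mat B. x\<^sup>2)"
    by (metis mset_map sum_mset_sum_list)
  also have "\<dots> = (\<Sum>i<n. (B $$ (i, i))\<^sup>2)"
    using B by (simp add: diag_mat_def o_def interv_sum_list_conv_sum_set_nat atLeast0LessThan)
  also have "\<dots> = mat_trace (B * B)"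
    using B upper_triangular_square_diag[OF B] by (simp add: mat_trace_def del: index_mult_mat(1))
  also have "\<dots> = mat_trace (A * A)"
  proof (rule mat_trace_similar[symmetric])
    have "similar_mat (A ^\<^sub>m 2) (B ^\<^sub>m 2)"
      using sim similar_mat_wit_pow unfolding similar_mat_def by blast
    then show "similar_mat (A * A) (B * B)"
      using A B by (simp add: numeral_2_eq_2)
  qed
  finally show ?thesis .
qed

section \<open>The Laplacian energy in terms of outdegrees and opposite arcs\<close>

lemma out_degree_eq_card_Image:
  "out_degree (with_proj G) v = card (parcs G `` {v})"
proof -
  have "out_arcs (with_proj G) v = Pair v ` (parcs G `` {v})"
    by (auto simp: out_arcs_def)
  then show ?thesis
    by (simp add: out_degree_def card_image inj_on_def)
qed

lemma sum_nth_distinct: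
  assumes "distinct vs"
  shows "(\<Sum>i<length vs. f (vs ! i)) = sum f (set vs)"
  using sum.reindex_bij_betw[OF bij_betw_nth[OF assms refl refl], of f] by simp

text \<open>Off the diagonal, \<open>L\<^sub>i\<^sub>j L\<^sub>j\<^sub>i\<close> detects a pair of opposite arcs.\<close>

lemma laplacian_energy_eq:
  assumes "pair_digraph G" and vs: "distinct vs" "set vs = pverts G"
  shows "laplacian_energy vs G =
    of_nat ((\<Sum>v\<in>pverts G. (card (parcs G `` {v}))\<^sup>2) + card (parcs G \<inter> (parcs G)\<inverse>))"
proof -
  interpret pair_digraph G by fact
  define L where "L = laplacian_mat vs G"
  define d where "d v = card (parcs G `` {v})" for v
  define E where "E = parcs G \<inter> (parcs G)\<inverse>"
  \<comment> \<open>The product of the entries at \<open>(u, v)\<close> and \<open>(v, u)\<close>: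
    the squared outdegree on the diagonal, and (-1)(-1) = 1 for opposite arcs. Without loops at most
    one summand is nonzero.\<close>
  define e :: "'a \<Rightarrow> 'a \<Rightarrow> nat"
    where "e u v = (if u = v then (d u)\<^sup>2 else 0) + (if (u, v) \<in> E then 1 else 0)" for u v
  have L: "L \<in> carrier_mat (length vs) (length vs)"
    by (rule carrier_matI) (simp_all add: L_def laplacian_mat_def out_degree_mat_def adjacency_mat_def)
  have entry: "L $$ (i, j) * L $$ (j, i) = of_nat (e (vs ! i) (vs ! j))"
    if "i < length vs" "j < length vs" for i j
    using that no_loops' nth_eq_iff_index_eq[OF vs(1) that]
    by (auto simp: L_def laplacian_mat_def out_degree_mat_def adjacency_mat_def e_def E_def d_def
        out_degree_eq_card_Image power2_eq_square)
  have "laplacian_energy vs G = mat_trace (L * L)"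
    unfolding laplacian_energy_def L_def[symmetric]
    by (rule sum_mset_proots_char_poly_square[OF L])
  also have "\<dots> = of_nat (\<Sum>i<length vs. \<Sum>j<length vs. e (vs ! i) (vs ! j))"
    using L by (simp add: mat_trace_mult entry)
  also have "(\<Sum>i<length vs. \<Sum>j<length vs. e (vs ! i) (vs ! j)) =
      (\<Sum>u\<in>pverts G. \<Sum>v\<in>pverts G. e u v)"
    using sum_nth_distinct[OF vs(1), of "\<lambda>u. sum (e u) (pverts G)"]
    by (simp add: sum_nth_distinct[OF vs(1)] vs(2))
  also have "\<dots> = (\<Sum>u\<in>pverts G. (d u)\<^sup>2) +
      (\<Sum>u\<in>pverts G. \<Sum>v\<in>pverts G. if (u, v) \<in> E then 1 else 0)"
    by (simp add: e_def sum.distrib)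
  also have "(\<Sum>u\<in>pverts G. \<Sum>v\<in>pverts G. if (u, v) \<in> E then 1 else 0) =
      (\<Sum>a\<in>pverts G \<times> pverts G. if a \<in> E then 1 else 0)"
    by (simp add: sum.cartesian_product)
  also have "\<dots> = card E"
  proof -
    have "E \<subseteq> pverts G \<times> pverts G"
      using in_arcsD1 in_arcsD2 by (auto simp: E_def)
    then show ?thesis
      by (simp add: sum.If_cases Int_absorb1)
  qed
  finally show ?thesis
    by (simp add: d_def E_def)
qed

section \<open>Weakly connected acyclic digraphs and in-trees\<close>

lemma parcs_mk_symmetric_with_proj:
  "parcs (mk_symmetric (with_proj G)) = parcs G \<union> (parcs G)\<inverse>"
  by (auto simp: parcs_mk_symmetric)

text \<open>A nonempty closed walk contains a cycle. The relational form gives well-foundedness for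
  finite arc sets, and with it sources and sinks.\<close>

lemma digraph_acyclic_imp_acyclic:
  assumes "pair_wf_digraph G" "digraph_acyclic G"
  shows "acyclic (parcs G)"
proof (rule acyclicI, intro allI notI)
  interpret pair_wf_digraph G by fact
  fix v assume "(v, v) \<in> (parcs G)\<^sup>+"
  then obtain p where "awalk v p v" "p \<noteq> []"
    using reachable1_awalk[of v v] by auto
  then have "closed_w p"
    by (auto simp: closed_w_def)
  then show False
    using closed_w_imp_cycle assms(2) by (auto simp: digraph_acyclic_def)
qed

text \<open>Passes from walks to a relation, whose powers can measure undirected distances.\<close>

lemma connected_imp_rtrancl:
  assumes "pair_wf_digraph G" "Digraph_Component.connected (with_proj G)"
    and "u \<in> pverts G" "v \<in> pverts G"
  shows "(u, v) \<in> (parcs G \<union> (parcs G)\<inverse>)\<^sup>*"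
proof -
  interpret pair_wf_digraph G by fact
  interpret S: pair_wf_digraph "mk_symmetric (with_proj G)" ..
  have "u \<rightarrow>\<^sup>*\<^bsub>with_proj (mk_symmetric (with_proj G))\<^esub> v"
    using assms by (auto simp: Digraph_Component.connected_def strongly_connected_def)
  then show ?thesis
    unfolding reachable_def using rtrancl_on_rtranclI[of u v]
    by (simp add: parcs_mk_symmetric_with_proj)
qed

text \<open>
  Fix a root and send every other vertex to an arc joining it to a vertex that is nearer to the
  root. The farther end of this arc is the vertex we started from, so the map is injective.
\<close>

lemma connected_card_verts_le:
  assumes "pair_fin_digraph G" and con: "Digraph_Component.connected (with_proj G)"
  shows "card (pverts G) \<le> card (parcs G) + 1"
proof -
  interpret pair_fin_digraph G by fact
  define S where "S = parcs G \<union> (parcs G)\<inverse>"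
  obtain r where r: "r \<in> pverts G"
    using con by (auto simp: Digraph_Component.connected_def strongly_connected_def)
  \<comment> \<open>The distance from the root in the underlying undirected graph.\<close>
  define d where "d v = (LEAST k. (r, v) \<in> S ^^ k)" for v
  have d_le: "d v \<le> k" if "(r, v) \<in> S ^^ k" for v k
    unfolding d_def using that by (rule Least_le)
  have "\<exists>u. (u, v) \<in> S \<and> d u < d v" if v: "v \<in> pverts G - {r}" for v
  proof -
    have "(r, v) \<in> S\<^sup>*"
      using connected_imp_rtrancl[OF _ con r] v pair_wf_digraph_axioms by (auto simp: S_def)
    then have dv: "(r, v) \<in> S ^^ d v"
      unfolding d_def by (metis LeastI_ex rtrancl_power)
    \<comment> \<open>As \<open>v\<close> is not the root, its distance is positive; the vertex
      before \<open>v\<close> on a shortest walk has distance at most \<open>k\<close>.\<close>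
    then obtain k where k: "d v = Suc k"
      using v by (cases "d v") auto
    then obtain u where "(r, u) \<in> S ^^ k" "(u, v) \<in> S"
      using dv by auto
    then show ?thesis
      using k d_le by (metis less_Suc_eq_le)
  qed
  then obtain p where p: "\<And>v. v \<in> pverts G - {r} \<Longrightarrow> (p v, v) \<in> S \<and> d (p v) < d v"
    by metis
  \<comment> \<open>At least one orientation of the edge between \<open>v\<close> and
    \<open>p v\<close> is an arc; \<open>e\<close> selects it.\<close>
  define e where "e v = (if (p v, v) \<in> parcs G then (p v, v) else (v, p v))" for v
  have "inj_on e (pverts G - {r})"
  proof (rule inj_onI)
    fix v w assume vw: "v \<in> pverts G - {r}" "w \<in> pverts G - {r}" "e v = e w"
    \<comment> \<open>If \<open>v\<close> and \<open>w\<close> differed, each would be strictly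
      nearer to the root than the other.\<close>
    then have "v = w \<or> v = p w \<and> w = p v"
      by (auto simp: e_def split: if_splits)
    then show "v = w"
      using p[OF vw(1)] p[OF vw(2)] by auto
  qed
  moreover have "e ` (pverts G - {r}) \<subseteq> parcs G"
    using p by (auto simp: e_def S_def)
  ultimately have "card (pverts G - {r}) \<le> card (parcs G)"
    using pair_finite_arcs by (rule card_inj_on_le)
  then show ?thesis
    using r pair_finite_verts by simp
qed

lemma card_parcs_eq_sum:
  assumes "pair_fin_digraph G"
  shows "card (parcs G) = (\<Sum>v\<in>pverts G. card (parcs G `` {v}))"
proof -
  interpret pair_fin_digraph G by fact
  have "parcs G = (SIGMA v:pverts G. parcs G `` {v})"
    using in_arcsD1 by auto
  moreover have "finite (parcs G `` {v})" for v
    using pair_finite_arcs by (rule finite_Image)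
  ultimately show ?thesis
    using pair_finite_verts by (metis card_SigmaI)
qed

text \<open>
  A vertex of an acyclic digraph that has no in-neighbour on a given undirected cycle has both of
  its neighbours on the cycle as out-neighbours.
\<close>

lemma acyclic_outdegree_le_1_no_cycle:
  assumes "finite A" "acyclic A" and deg: "\<And>v. card (A `` {v}) \<le> 1"
    and q: "distinct q" "3 \<le> length q"
    and adj: "\<And>i. i < length q \<Longrightarrow> (q ! i, q ! (Suc i mod length q)) \<in> A \<union> A\<inverse>"
  shows False
proof -
  have "wf A"
    using assms by (intro finite_acyclic_wf)
  moreover have "q ! 0 \<in> set q"
    using q by (intro nth_mem) auto
  ultimately obtain z where z: "z \<in> set q" and min: "\<And>y. (y, z) \<in> A \<Longrightarrow> y \<notin> set q"
    by (rule wfE_min) blast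
  obtain i where i: "i < length q" "q ! i = z"
    using z by (auto simp: in_set_conv_nth)
  \<comment> \<open>The positions after and before \<open>i\<close> in cyclic order; they differ
    because the length is at least 3.\<close>
  define a where "a = Suc i mod length q"
  define b where "b = (if i = 0 then length q - 1 else i - 1)"
  have ab: "a < length q" "b < length q" "a \<noteq> b"
    using i q by (auto simp: a_def b_def mod_Suc)
  have "Suc b mod length q = i"
    using i by (auto simp: b_def)
  then have "(q ! b, z) \<in> A \<union> A\<inverse>" "(z, q ! a) \<in> A \<union> A\<inverse>"
    using adj[OF ab(2)] adj[OF i(1)] i by (simp_all add: a_def)
  then have "{q ! a, q ! b} \<subseteq> A `` {z}"
    using min nth_mem[OF ab(1)] nth_mem[OF ab(2)] by blast
  then have "card {q ! a, q ! b} \<le> 1"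
    using deg[of z] card_mono[of "A `` {z}"] finite_Image[OF assms(1)] le_trans by blast
  then show False
    using ab q by (simp add: nth_eq_iff_index_eq)
qed

lemma pcas_nth:
  assumes "pcas u p v" "Suc i < length p"
  shows "fst (p ! Suc i) = snd (p ! i)"
  using assms by (induction p arbitrary: u i) (auto simp: nth_Cons' neq_Nil_conv gr0_conv_Suc)

lemma pcas_ends:
  assumes "pcas u p v" "p \<noteq> []"
  shows "fst (p ! 0) = u" "snd (p ! (length p - 1)) = v"
  using assms by (induction p arbitrary: u) (auto simp: nth_Cons')

text \<open>An undirected cycle, given as a list of arcs, is turned into the list of their heads, to
  which the preceding exclusion of cyclic vertex sequences applies.\<close>

lemma acyclic_outdegree_le_1_imp_in_tree:
  assumes "pair_digraph G" and con: "Digraph_Component.connected (with_proj G)"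
    and acyc: "acyclic (parcs G)" and deg: "\<And>v. v \<in> pverts G \<Longrightarrow> card (parcs G `` {v}) \<le> 1"
  shows "in_tree G"
proof -
  interpret pair_digraph G by fact
  interpret S: pair_wf_digraph "mk_symmetric (with_proj G)" ..
  have "\<not> S.cycle p" if len: "3 \<le> length p" for p
  proof
    assume "S.cycle p"
    then obtain u where p: "set p \<subseteq> parcs G \<union> (parcs G)\<inverse>" "pcas u p u"
      "distinct (tl (pawalk_verts u p))"
      by (auto simp: S.cycle_def S.awalk_def parcs_mk_symmetric_with_proj)
    \<comment> \<open>The heads list every vertex of the cycle once, with the start \<open>u\<close>
      in last position.\<close>
    have q: "distinct (map snd p)"
      using p(3) S.awalk_verts_conv'[of u p u] p(2) by (auto split: if_splits)
    have adj: "(map snd p ! i, map snd p ! (Suc i mod length p)) \<in> parcs G \<union> (parcs G)\<inverse>"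
      if i: "i < length p" for i
    proof -
      have j: "Suc i mod length p < length p"
        using i by (intro mod_less_divisor) linarith
      have "fst (p ! (Suc i mod length p)) = snd (p ! i)"
      \<comment> \<open>At the wrap-around the last arc ends in \<open>u\<close>, where the first
        one begins.\<close>
      proof (cases "Suc i = length p")
        case True
        then have "i = length p - 1" "p \<noteq> []" by auto
        then show ?thesis
          using True pcas_ends[OF p(2)] by simp
      next
        case False
        then show ?thesis
          using i pcas_nth[OF p(2)] by simp
      qed
      then have "p ! (Suc i mod length p) = (snd (p ! i), snd (p ! (Suc i mod length p)))"
        by (simp add: prod_eq_iff)
      moreover have "p ! (Suc i mod length p) \<in> parcs G \<union> (parcs G)\<inverse>"
        using p(1) j nth_mem by blast
      ultimately show ?thesis
        using i j by simp
    qed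
    have "card (parcs G `` {v}) \<le> 1" for v
    proof (cases "v \<in> pverts G")
      case False
      then have "parcs G `` {v} = {}"
        using in_arcsD1 by auto
      then show ?thesis by simp
    qed (rule deg)
    then show False
      using acyclic_outdegree_le_1_no_cycle[OF pair_finite_arcs acyc _ q] len adj by simp
  qed
  then show ?thesis
    using con deg by (auto simp: in_tree_def underlying_tree_def out_degree_eq_card_Image)
qed

text \<open>A nonempty finite acyclic digraph has a sink, which contributes no arc; every other
  vertex contributes at most one.\<close>

lemma acyclic_outdegree_le_1_card_parcs:
  assumes "pair_fin_digraph G" "pverts G \<noteq> {}" "acyclic (parcs G)"
    and deg: "\<And>v. v \<in> pverts G \<Longrightarrow> card (parcs G `` {v}) \<le> 1"
  shows "card (parcs G) + 1 \<le> card (pverts G)"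
proof -
  interpret pair_fin_digraph G by fact
  obtain v where "v \<in> pverts G"
    using assms by blast
  moreover have "wf ((parcs G)\<inverse>)"
    using assms pair_finite_arcs by (intro finite_acyclic_wf_converse)
  ultimately obtain z where z: "z \<in> pverts G" "\<And>y. (z, y) \<in> parcs G \<Longrightarrow> y \<notin> pverts G"
    by (metis converse_iff wfE_min)
  then have "parcs G `` {z} = {}"
    using in_arcsD2 by auto
  then have "(\<Sum>v\<in>pverts G. card (parcs G `` {v})) = (\<Sum>v\<in>pverts G - {z}. card (parcs G `` {v}))"
    using z pair_finite_verts by (simp add: sum.remove)
  also have "\<dots> \<le> card (pverts G - {z})"
    using deg sum_bounded_above[of "pverts G - {z}" "\<lambda>v. card (parcs G `` {v})" 1] by simp
  finally show ?thesis
    using z pair_finite_verts card_gt_0_iff[of "pverts G"]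
    by (auto simp: card_parcs_eq_sum[OF assms(1)])
qed

text \<open>A natural number is at most its square, with equality only for 0 and 1. The minimum
  order minus one therefore forces outdegrees at most one, and conversely such outdegrees equal
  their squares.\<close>

lemma sum_square_outdegree:
  assumes "pair_digraph G" and con: "Digraph_Component.connected (with_proj G)"
    and "digraph_acyclic G"
  defines "q \<equiv> \<Sum>v\<in>pverts G. (card (parcs G `` {v}))\<^sup>2"
  shows "card (parcs G) \<le> q" "q + 1 = card (pverts G) \<longleftrightarrow> in_tree G"
proof -
  interpret pair_digraph G by fact
  let ?d = "\<lambda>v. card (parcs G `` {v})"
  have le: "?d v \<le> (?d v)\<^sup>2" for v
    by (simp add: power2_eq_square)
  note m = card_parcs_eq_sum[OF pair_fin_digraph]
  show mq: "card (parcs G) \<le> q"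
    unfolding m q_def by (intro sum_mono le)
  have acyc: "acyclic (parcs G)"
    using assms by (intro digraph_acyclic_imp_acyclic) auto
  have nm: "card (pverts G) \<le> card (parcs G) + 1"
    using con by (intro connected_card_verts_le) auto
  show "q + 1 = card (pverts G) \<longleftrightarrow> in_tree G"
  proof
    assume "q + 1 = card (pverts G)"
    \<comment> \<open>The number of arcs is squeezed between the order minus one and
      \<open>q\<close>, which now coincide.\<close>
    then have "(\<Sum>v\<in>pverts G. ?d v) = (\<Sum>v\<in>pverts G. (?d v)\<^sup>2)"
      using mq nm by (simp add: m q_def)
    then have "?d v = (?d v)\<^sup>2" if "v \<in> pverts G" for v
      using sum_mono_inv[of ?d "pverts G" "\<lambda>v. (?d v)\<^sup>2"] le that pair_finite_verts by blast
    then have "?d v \<le> 1" if "v \<in> pverts G" for v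
      using that by (metis One_nat_def le_eq_less_or_eq less_one linorder_not_less
          mult_cancel2 power2_eq_square mult_1)
    then show "in_tree G"
      using assms acyc by (intro acyclic_outdegree_le_1_imp_in_tree)
  next
    assume "in_tree G"
    then have deg: "?d v \<le> 1" if "v \<in> pverts G" for v
      using that by (auto simp: in_tree_def out_degree_eq_card_Image)
    have "(?d v)\<^sup>2 = ?d v" if "v \<in> pverts G" for v
      using deg[OF that] by (cases "?d v") auto
    then have "q = card (parcs G)"
      unfolding q_def m by (intro sum.cong) auto
    moreover have "pverts G \<noteq> {}"
      using con by (auto simp: Digraph_Component.connected_def strongly_connected_def)
    then have "card (parcs G) + 1 \<le> card (pverts G)"
      using acyc deg by (intro acyclic_outdegree_le_1_card_parcs) auto
    ultimately show "q + 1 = card (pverts G)"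
      using nm by simp
  qed
qed

section \<open>Outdegrees and opposite arcs in iterated joins\<close>

lemma iterated_join_Suc:
  "1 \<le> r \<Longrightarrow> iterated_join V (Suc r) = digraph_join (iterated_join V r) (V (Suc r))"
  by (simp add: iterated_join_def)

lemma pverts_iterated_join:
  "1 \<le> r \<Longrightarrow> pverts (iterated_join V r) = (\<Union>i\<in>{1..r}. pverts (V i))"
proof (induction r rule: dec_induct)
  case base
  then show ?case by (simp add: iterated_join_def)
next
  case (step r)
  then show ?case
    by (simp add: iterated_join_Suc digraph_join_def atLeastAtMostSuc_conv Un_commute)
qed

text \<open>Removes the dependence on the bracketing, so that all factors can be treated
  alike.\<close>

lemma parcs_iterated_join:
  assumes "1 \<le> r"
  shows "parcs (iterated_join V r) = (\<Union>i\<in>{1..r}. parcs (V i)) \<union>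
    (\<Union>i\<in>{1..r}. \<Union>j\<in>{1..r} - {i}. pverts (V i) \<times> pverts (V j))"
  using assms
proof (induction r rule: dec_induct)
  case base
  then show ?case by (simp add: iterated_join_def)
next
  case (step r)
  have "{1..Suc r} - {Suc r} = {1..r}"
    by auto
  moreover have "{1..Suc r} - {i} = insert (Suc r) ({1..r} - {i})" if "i \<in> {1..r}" for i
    using that by auto
  \<comment> \<open>Pairs of distinct indices up to \<open>Suc r\<close> either stay within
    \<open>r\<close> or contain \<open>Suc r\<close> exactly once.\<close>
  ultimately have "(\<Union>i\<in>{1..Suc r}. \<Union>j\<in>{1..Suc r} - {i}. pverts (V i) \<times> pverts (V j)) =
      (\<Union>i\<in>{1..r}. \<Union>j\<in>{1..r} - {i}. pverts (V i) \<times> pverts (V j)) \<union>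
      pverts (iterated_join V r) \<times> pverts (V (Suc r)) \<union>
      pverts (V (Suc r)) \<times> pverts (iterated_join V r)"
    using step.hyps by (auto simp: atLeastAtMostSuc_conv pverts_iterated_join)
  then show ?case
    using step by (auto simp: iterated_join_Suc digraph_join_def atLeastAtMostSuc_conv)
qed

locale acyclic_join =
  fixes V :: "nat \<Rightarrow> 'a pair_pre_digraph" and r :: nat
  assumes r: "1 \<le> r"
    and digraph: "\<And>i. i \<in> {1..r} \<Longrightarrow> pair_digraph (V i)"
    and acyc: "\<And>i. i \<in> {1..r} \<Longrightarrow> digraph_acyclic (V i)"
    and disj: "disjoint_family_on (\<lambda>i. pverts (V i)) {1..r}"
begin

abbreviation "G \<equiv> iterated_join V r"

lemma index_unique:
  assumes "i \<in> {1..r}" "j \<in> {1..r}" "v \<in> pverts (V i)" "v \<in> pverts (V j)"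
  shows "i = j"
  using disjoint_family_onD[OF disj assms(1,2)] assms(3,4) by auto

lemma arc_verts:
  assumes "i \<in> {1..r}" "(u, v) \<in> parcs (V i)"
  shows "u \<in> pverts (V i)" "v \<in> pverts (V i)" "u \<noteq> v"
proof -
  interpret pair_digraph "V i" using digraph[OF assms(1)] .
  show "u \<in> pverts (V i)" "v \<in> pverts (V i)" "u \<noteq> v"
    using assms in_arcsD1 in_arcsD2 no_loops' by auto
qed

lemma finite_pverts: "i \<in> {1..r} \<Longrightarrow> finite (pverts (V i))"
  by (metis digraph pair_digraph_def pair_fin_digraph.pair_finite_verts)

lemma finite_G: "finite (pverts G)"
  using finite_pverts by (auto simp: pverts_iterated_join[OF r])

text \<open>Disjointness lets a vertex determine its factor, so the indices in the unions describing
  the arcs are forced.\<close>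

lemma parcs_iff:
  assumes "i \<in> {1..r}" "j \<in> {1..r}" "u \<in> pverts (V i)" "v \<in> pverts (V j)"
  shows "(u, v) \<in> parcs G \<longleftrightarrow> i \<noteq> j \<or> (u, v) \<in> parcs (V i)"
proof -
  have "(\<exists>k\<in>{1..r}. (u, v) \<in> parcs (V k)) \<longleftrightarrow> (u, v) \<in> parcs (V i)"
    using assms(1,3) arc_verts(1) index_unique by metis
  moreover have "(\<exists>k\<in>{1..r}. \<exists>l\<in>{1..r} - {k}. u \<in> pverts (V k) \<and> v \<in> pverts (V l)) \<longleftrightarrow> i \<noteq> j"
    using assms index_unique by (metis Diff_iff singleton_iff)
  ultimately show ?thesis
    unfolding parcs_iterated_join[OF r] by blast
qed

lemma parcs_verts: "parcs G \<subseteq> pverts G \<times> pverts G"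
proof -
  have "parcs (V i) \<subseteq> pverts (V i) \<times> pverts (V i)" if "i \<in> {1..r}" for i
    using arc_verts[OF that] by auto
  then show ?thesis
    unfolding parcs_iterated_join[OF r] pverts_iterated_join[OF r] by blast
qed

lemma pair_digraph_join: "pair_digraph G"
proof
  show "fst e \<in> pverts G" "snd e \<in> pverts G" if "e \<in> parcs G" for e
    using that parcs_verts by auto
  show "finite (pverts G)" by (rule finite_G)
  then show "finite (parcs G)"
    by (rule finite_subset[OF parcs_verts, OF finite_cartesian_product]) (rule finite_G)
  show "fst e \<noteq> snd e" if "e \<in> parcs G" for e
  proof
    assume eq: "fst e = snd e"
    have "fst e \<in> pverts G"
      using that parcs_verts by auto
    then obtain i where "i \<in> {1..r}" "fst e \<in> pverts (V i)"
      unfolding pverts_iterated_join[OF r] by blast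
    then show False
      using parcs_iff[of i i "fst e" "snd e"] arc_verts(3)[of i "fst e" "snd e"] that eq
      by (metis prod.collapse)
  qed
qed

text \<open>The out-neighbours of \<open>v\<close> are those inside its factor and all vertices of
  the other factors. The subtraction does not truncate, since a factor has at most as many vertices
  as the join.\<close>

lemma outdegree_join:
  assumes "i \<in> {1..r}" "v \<in> pverts (V i)"
  shows "card (parcs G `` {v}) = card (parcs (V i) `` {v}) + card (pverts G) - card (pverts (V i))"
proof -
  have sub: "pverts (V i) \<subseteq> pverts G"
    using assms by (auto simp: pverts_iterated_join[OF r])
  have "parcs G `` {v} = parcs (V i) `` {v} \<union> (pverts G - pverts (V i))"
  proof (rule Set.set_eqI)
    fix w
    consider j where "j \<in> {1..r}" "w \<in> pverts (V j)" | "w \<notin> pverts G"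
      unfolding pverts_iterated_join[OF r] by blast
    then show "w \<in> parcs G `` {v} \<longleftrightarrow> w \<in> parcs (V i) `` {v} \<union> (pverts G - pverts (V i))"
    proof cases
      case 1
      have "w \<in> pverts G" "w \<in> pverts (V i) \<longleftrightarrow> i = j"
        using 1 assms(1) index_unique[of i j w] by (auto simp: pverts_iterated_join[OF r])
      then show ?thesis
        using parcs_iff[OF assms(1) 1(1) assms(2) 1(2)] by auto
    next
      case 2
      then show ?thesis
        using assms sub parcs_verts arc_verts(2)[of i v w] by auto
    qed
  qed
  moreover have "parcs (V i) `` {v} \<inter> (pverts G - pverts (V i)) = {}" "parcs (V i) `` {v} \<subseteq> pverts (V i)"
    using arc_verts assms(1) by auto
  ultimately show ?thesis
    using finite_G finite_pverts[OF assms(1)] sub card_mono[OF finite_G sub]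
    by (simp add: card_Un_disjoint card_Diff_subset finite_subset)
qed

text \<open>Different factors are joined in both directions, whereas opposite arcs inside a factor
  would close a cycle of length two.\<close>

lemma opposite_arcs_join:
  "parcs G \<inter> (parcs G)\<inverse> =
    pverts G \<times> pverts G - (\<Union>i\<in>{1..r}. pverts (V i) \<times> pverts (V i))"
proof (rule Set.set_eqI)
  fix e :: "'a \<times> 'a"
  obtain u v where e: "e = (u, v)" by fastforce
  consider i j where "i \<in> {1..r}" "u \<in> pverts (V i)" "j \<in> {1..r}" "v \<in> pverts (V j)"
    | "(u, v) \<notin> pverts G \<times> pverts G"
    unfolding pverts_iterated_join[OF r] by blast
  then show "e \<in> parcs G \<inter> (parcs G)\<inverse> \<longleftrightarrow>
      e \<in> pverts G \<times> pverts G - (\<Union>i\<in>{1..r}. pverts (V i) \<times> pverts (V i))"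
  proof cases
    case 1
    have "acyclic (parcs (V i))"
      using digraph_acyclic_imp_acyclic[OF _ acyc[OF 1(1)]] digraph[OF 1(1)]
      by (auto intro: pair_digraph.pair_wf_digraph)
    then have "\<not> ((u, v) \<in> parcs (V i) \<and> (v, u) \<in> parcs (V i))"
      by (meson acyclic_def trancl.intros)
    then have "e \<in> parcs G \<inter> (parcs G)\<inverse> \<longleftrightarrow> i \<noteq> j"
      using 1 parcs_iff[of i j u v] parcs_iff[of j i v u] e by blast
    also have "\<dots> \<longleftrightarrow> e \<in> pverts G \<times> pverts G - (\<Union>i\<in>{1..r}. pverts (V i) \<times> pverts (V i))"
    proof -
      have "(u, v) \<in> pverts G \<times> pverts G"
        using 1 by (auto simp: pverts_iterated_join[OF r])
      moreover have "i = j \<longleftrightarrow> (\<exists>k\<in>{1..r}. u \<in> pverts (V k) \<and> v \<in> pverts (V k))"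
        using 1 index_unique by metis
      ultimately show ?thesis
        using e by auto
    qed
    finally show ?thesis .
  next
    case 2
    then show ?thesis
      using parcs_verts e by auto
  qed
qed

text \<open>All ordered pairs are split into opposite arcs and pairs within one factor; the additive
  form avoids truncated subtraction.\<close>

lemma card_opposite_arcs_join:
  "card (parcs G \<inter> (parcs G)\<inverse>) + (\<Sum>i=1..r. (card (pverts (V i)))\<^sup>2) = (card (pverts G))\<^sup>2"
proof -
  let ?D = "\<Union>i\<in>{1..r}. pverts (V i) \<times> pverts (V i)"
  have fin: "finite (pverts G \<times> pverts G)"
    using finite_G by simp
  have sub: "?D \<subseteq> pverts G \<times> pverts G"
    by (auto simp: pverts_iterated_join[OF r])
  have "card ?D = (\<Sum>i=1..r. card (pverts (V i) \<times> pverts (V i)))"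
    using finite_pverts index_unique by (intro card_UN_disjoint) auto
  also have "\<dots> = (\<Sum>i=1..r. (card (pverts (V i)))\<^sup>2)"
    by (simp add: card_cartesian_product power2_eq_square)
  finally show ?thesis
    using card_mono[OF fin sub] fin sub finite_subset[OF sub fin]
    by (simp add: opposite_arcs_join card_Diff_subset card_cartesian_product power2_eq_square)
qed

text \<open>Each outdegree is the one in the factor plus a constant for that factor. In the expanded
  square, the linear terms add up to the number of arcs.\<close>

lemma sum_square_outdegree_join:
  defines "n \<equiv> card (pverts G)"
  shows "int (\<Sum>v\<in>pverts G. (card (parcs G `` {v}))\<^sup>2) = (\<Sum>i=1..r.
    int (\<Sum>v\<in>pverts (V i). (card (parcs (V i) `` {v}))\<^sup>2) +
    2 * (int n - int (card (pverts (V i)))) * int (card (parcs (V i))) +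
    int (card (pverts (V i))) * (int n - int (card (pverts (V i))))\<^sup>2)"
proof -
  have "int (\<Sum>v\<in>pverts G. (card (parcs G `` {v}))\<^sup>2) =
      (\<Sum>i=1..r. \<Sum>v\<in>pverts (V i). (int (card (parcs G `` {v})))\<^sup>2)"
    unfolding pverts_iterated_join[OF r] of_nat_sum of_nat_power
    using finite_pverts index_unique by (intro sum.UNION_disjoint) auto
  also have "\<dots> = (\<Sum>i=1..r.
    int (\<Sum>v\<in>pverts (V i). (card (parcs (V i) `` {v}))\<^sup>2) +
    2 * (int n - int (card (pverts (V i)))) * int (card (parcs (V i))) +
    int (card (pverts (V i))) * (int n - int (card (pverts (V i))))\<^sup>2)"
  proof (intro sum.cong refl)
    fix i assume i: "i \<in> {1..r}"
    let ?N = "int (card (pverts (V i)))" and ?d = "\<lambda>v. int (card (parcs (V i) `` {v}))"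
    interpret pair_digraph "V i" using digraph[OF i] .
    have "card (pverts (V i)) \<le> n"
      using i unfolding n_def pverts_iterated_join[OF r]
      by (intro card_mono) (auto intro: finite_pverts)
    then have "(int (card (parcs G `` {v})))\<^sup>2 = (?d v)\<^sup>2 + 2 * (int n - ?N) * ?d v + (int n - ?N)\<^sup>2"
      if "v \<in> pverts (V i)" for v
      using outdegree_join[OF i that]
      by (simp add: n_def[symmetric] of_nat_diff power2_eq_square algebra_simps)
    then have "(\<Sum>v\<in>pverts (V i). (int (card (parcs G `` {v})))\<^sup>2) =
        (\<Sum>v\<in>pverts (V i). (?d v)\<^sup>2 + 2 * (int n - ?N) * ?d v + (int n - ?N)\<^sup>2)"
      by (intro sum.cong) auto
    then show "(\<Sum>v\<in>pverts (V i). (int (card (parcs G `` {v})))\<^sup>2) =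
      int (\<Sum>v\<in>pverts (V i). (card (parcs (V i) `` {v}))\<^sup>2) +
      2 * (int n - ?N) * int (card (parcs (V i))) + ?N * (int n - ?N)\<^sup>2"
      by (simp add: card_parcs_eq_sum[OF pair_fin_digraph] sum.distrib sum_distrib_left)
  qed
  finally show ?thesis .
qed

end

section \<open>Arithmetic of the orders of the factors\<close>

text \<open>
  The numbers \<open>x i\<close> are the orders of the factors minus one and sum up to \<open>X\<close>. The last summand
  comes from \<open>x * (2 * n - x)\<close> being increasing in \<open>x\<close> on \<open>{0..n}\<close>.
\<close>

lemma energy_excess:
  fixes N q m :: "'i \<Rightarrow> int" and n :: int
  assumes "finite I" and n: "(\<Sum>i\<in>I. N i) = n"
  defines "r \<equiv> int (card I)"
  defines "X \<equiv> n - r" and "x \<equiv> \<lambda>i. N i - 1"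
  shows "(\<Sum>i\<in>I. q i + 2 * (n - N i) * m i + N i * (n - N i)\<^sup>2 - (N i)\<^sup>2) + n\<^sup>2 =
    (r - 1) * n\<^sup>2 + r\<^sup>2 * n - r ^ 3 +
    (\<Sum>i\<in>I. (q i - x i) + 2 * (n - N i) * (m i - x i) + x i * (X - x i) * (2 * n - X - x i))"
    (is "sum ?e I + _ = _ + sum ?t I")
proof -
  \<comment> \<open>The terms with \<open>q\<close> and \<open>m\<close> cancel, as do all powers of
    \<open>x i\<close> above the first, so only the total \<open>X\<close> of the \<open>x i\<close>
    matters.\<close>
  have "sum ?e I - sum ?t I = (\<Sum>i\<in>I. n\<^sup>2 - 2 * n + (n\<^sup>2 - 2 * n - 2 * n * X + X\<^sup>2) * x i)"
    unfolding sum_subtractf[symmetric]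
    by (intro sum.cong refl) (simp add: x_def power2_eq_square power3_eq_cube algebra_simps)
  also have "\<dots> = r * (n\<^sup>2 - 2 * n) + (n\<^sup>2 - 2 * n - 2 * n * X + X\<^sup>2) * X"
    using n by (simp add: sum.distrib sum_distrib_left[symmetric] x_def X_def r_def sum_subtractf)
  finally show ?thesis
    by (simp add: X_def power2_eq_square power3_eq_cube algebra_simps)
qed

text \<open>The largest value is \<open>x 1\<close>. If it is 0, all values and their sum vanish;
  otherwise it equals the sum and leaves 0 for the rest.\<close>

lemma all_zero_or_sum_iff:
  fixes x :: "nat \<Rightarrow> nat"
  assumes "1 \<le> r" and mono: "\<And>i. i \<in> {1..r} \<Longrightarrow> x i \<le> x 1"
  shows "(\<forall>i\<in>{1..r}. x i = 0 \<or> x i = (\<Sum>i=1..r. x i)) \<longleftrightarrow>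
    x 1 = (\<Sum>i=1..r. x i) \<and> (\<forall>i\<in>{2..r}. x i = 0)"
proof -
  have split: "{1..r} = insert 1 {2..r}"
    using assms(1) by auto
  then have sum: "(\<Sum>i=1..r. x i) = x 1 + (\<Sum>i=2..r. x i)"
    by simp
  show ?thesis
  proof
    assume *: "\<forall>i\<in>{1..r}. x i = 0 \<or> x i = (\<Sum>i=1..r. x i)"
    have "x 1 = (\<Sum>i=1..r. x i)"
    proof (cases "x 1 = 0")
      case True
      then have "x i = 0" if "i \<in> {1..r}" for i
        using mono[OF that] by simp
      then show ?thesis
        using assms(1) by simp
    next
      case False
      moreover have "1 \<in> {1..r}"
        using assms(1) by simp
      ultimately show ?thesis
        using * by metis
    qed
    then show "x 1 = (\<Sum>i=1..r. x i) \<and> (\<forall>i\<in>{2..r}. x i = 0)"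
      using sum by simp
  next
    assume "x 1 = (\<Sum>i=1..r. x i) \<and> (\<forall>i\<in>{2..r}. x i = 0)"
    then show "\<forall>i\<in>{1..r}. x i = 0 \<or> x i = (\<Sum>i=1..r. x i)"
      unfolding split by auto
  qed
qed

section \<open>The energy of the join against its lower bound\<close>

theorem theorem2p5:
  fixes V :: "nat \<Rightarrow> 'a pair_pre_digraph" and N :: "nat \<Rightarrow> nat" and n r :: nat
    and G :: "'a pair_pre_digraph" and vs :: "'a list"
  assumes "1 \<le> r" and "r \<le> n"
    and "\<And>i. i \<in> {1..r} \<Longrightarrow> pair_digraph (V i)"
    and "\<And>i. i \<in> {1..r} \<Longrightarrow> Digraph_Component.connected (with_proj (V i))"
    and "\<And>i. i \<in> {1..r} \<Longrightarrow> digraph_acyclic (V i)"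
    and "disjoint_family_on (\<lambda>i. pverts (V i)) {1..r}"
    and "\<And>i. i \<in> {1..r} \<Longrightarrow> card (pverts (V i)) = N i"
    and "\<And>i j. 1 \<le> i \<Longrightarrow> i \<le> j \<Longrightarrow> j \<le> r \<Longrightarrow> N j \<le> N i"
    and "1 \<le> N r"
    and "(\<Sum>i=1..r. N i) = n"
    and "G = iterated_join V r"
    and "card (pverts G) = n"
    and "distinct vs" and "set vs = pverts G"
  shows "laplacian_energy vs G \<in> \<real> \<and>
    Re (laplacian_energy vs G) \<ge>
      (real r - 1) * (real n)\<^sup>2 + (real r)\<^sup>2 * real n - (real r)^3 \<and>
    (laplacian_energy vs G =
      complex_of_real ((real r - 1) * (real n)\<^sup>2 + (real r)\<^sup>2 * real n - (real r)^3)
     \<longleftrightarrow> (\<forall>i\<in>{1..r}. in_tree (V i)) \<and> N 1 = n - r + 1 \<and> (\<forall>i\<in>{2..r}. N i = 1))"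
proof -
  interpret J: acyclic_join V r
    by (rule acyclic_join.intro) (fact assms)+
  define q where "q i = (\<Sum>v\<in>pverts (V i). (card (parcs (V i) `` {v}))\<^sup>2)" for i
  define m where "m i = card (parcs (V i))" for i
  define x where "x i = N i - 1" for i
  define X where "X = n - r"
  define E where "E = (\<Sum>v\<in>pverts G. (card (parcs G `` {v}))\<^sup>2) + card (parcs G \<inter> (parcs G)\<inverse>)"
  \<comment> \<open>The bound is an integer, so the comparison takes place in \<open>int\<close> and
    is cast to the reals only at the end.\<close>
  define B where "B = (int r - 1) * (int n)\<^sup>2 + (int r)\<^sup>2 * int n - int r ^ 3"
  \<comment> \<open>The excess due to factor \<open>i\<close>. With \<open>X = n - r\<close>, the
    factor \<open>n + r - x i\<close> is \<open>2 * n - X - x i\<close>, so the last product is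
    \<open>x i\<close> times the difference between the values of y (2 n - y) at \<open>X\<close>
    and at \<open>x i\<close>.\<close>
  define t where "t i = int (q i - x i) + 2 * (int n - int (N i)) * int (m i - x i) +
    int (x i) * int (X - x i) * (int n + int r - int (x i))" for i
  have energy: "laplacian_energy vs G = of_nat E"
    unfolding E_def using laplacian_energy_eq J.pair_digraph_join assms by blast
  have N1: "1 \<le> N i" if "i \<in> {1..r}" for i
    using assms(8)[of i r] assms(9) that by simp
  have Nn: "N i \<le> n" if "i \<in> {1..r}" for i
    using member_le_sum[of i "{1..r}" N] that assms(10) by simp
  have sumx: "(\<Sum>i=1..r. x i) = X"
    unfolding x_def X_def using sum_subtractf_nat[of "{1..r}" "\<lambda>_. 1" N] N1 assms(10) by simp
  have xX: "x i \<le> X" if "i \<in> {1..r}" for i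
    using member_le_sum[of i "{1..r}" x] that sumx by simp
  have nm: "x i \<le> m i" if "i \<in> {1..r}" for i
    using connected_card_verts_le[of "V i"] assms(3,4,7)[OF that]
    by (auto simp: x_def m_def pair_digraph_def)
  have mq: "m i \<le> q i" and tree: "q i + 1 = N i \<longleftrightarrow> in_tree (V i)" if "i \<in> {1..r}" for i
    using sum_square_outdegree[OF assms(3-5)[OF that]] assms(7)[OF that]
    by (auto simp: m_def q_def)
  have excess: "int E = B + (\<Sum>i=1..r. t i)"
  proof -
    have "int E = (\<Sum>i=1..r. int (q i) + 2 * (int n - int (N i)) * int (m i) +
        int (N i) * (int n - int (N i))\<^sup>2) + int (card (parcs G \<inter> (parcs G)\<inverse>))"
      using J.sum_square_outdegree_join assms(7,11,12) by (simp add: E_def q_def m_def)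
    moreover have "int (card (parcs G \<inter> (parcs G)\<inverse>)) + (\<Sum>i=1..r. (int (N i))\<^sup>2) = (int n)\<^sup>2"
      using arg_cong[OF J.card_opposite_arcs_join, of int] assms(7,11,12) by simp
    ultimately have "int E = (\<Sum>i=1..r. int (q i) + 2 * (int n - int (N i)) * int (m i) +
        int (N i) * (int n - int (N i))\<^sup>2 - (int (N i))\<^sup>2) + (int n)\<^sup>2"
      by (simp add: sum_subtractf)
    also have "\<dots> = B + (\<Sum>i=1..r. (int (q i) - (int (N i) - 1)) +
        2 * (int n - int (N i)) * (int (m i) - (int (N i) - 1)) +
        (int (N i) - 1) * (int n - int r - (int (N i) - 1)) *
          (2 * int n - (int n - int r) - (int (N i) - 1)))"
      using energy_excess[of "{1..r}" "\<lambda>i. int (N i)" "int n" "\<lambda>i. int (q i)" "\<lambda>i. int (m i)"]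
        arg_cong[OF assms(10), of int] by (simp add: B_def)
    also have "\<dots> = B + (\<Sum>i=1..r. t i)"
    proof (intro arg_cong2[of _ _ _ _ "(+)"] sum.cong refl)
      fix i assume i: "i \<in> {1..r}"
      \<comment> \<open>None of the natural subtractions in \<open>t\<close> truncates, because
        \<open>x i\<close> is at most \<open>m i\<close>, \<open>q i\<close> and
        \<open>X\<close>.\<close>
      have "int (q i - x i) = int (q i) - (int (N i) - 1)" "int (m i - x i) = int (m i) - (int (N i) - 1)"
        "int (x i) = int (N i) - 1" "int (X - x i) = int n - int r - (int (N i) - 1)"
        using N1[OF i] nm[OF i] mq[OF i] xX[OF i] assms(2) by (auto simp: x_def X_def)
      then show "(int (q i) - (int (N i) - 1)) +
        2 * (int n - int (N i)) * (int (m i) - (int (N i) - 1)) +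
        (int (N i) - 1) * (int n - int r - (int (N i) - 1)) *
          (2 * int n - (int n - int r) - (int (N i) - 1)) = t i"
        by (simp add: t_def)
    qed
    finally show ?thesis .
  qed
  have pos: "0 < int n + int r - int (x i)" if "i \<in> {1..r}" for i
    using Nn[OF that] N1[OF that] by (auto simp: x_def)
  have t0: "0 \<le> t i" if "i \<in> {1..r}" for i
    using pos[OF that] Nn[OF that] by (auto simp: t_def)
  have t_eq: "t i = 0 \<longleftrightarrow> in_tree (V i) \<and> (x i = 0 \<or> x i = X)" if i: "i \<in> {1..r}" for i
  proof -
    have "0 \<le> 2 * (int n - int (N i)) * int (m i - x i)"
      "0 \<le> int (x i) * int (X - x i) * (int n + int r - int (x i))"
      using pos[OF i] Nn[OF i] by auto
    then have "t i = 0 \<longleftrightarrow> int (q i - x i) = 0 \<and> 2 * (int n - int (N i)) * int (m i - x i) = 0 \<and>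
        int (x i) * int (X - x i) * (int n + int r - int (x i)) = 0"
      unfolding t_def by linarith
    \<comment> \<open>If \<open>q i = x i\<close>, then \<open>m i\<close>, lying between them,
      equals both, and the middle summand vanishes as well. In the last product the third factor is
      positive.\<close>
    also have "\<dots> \<longleftrightarrow> q i = x i \<and> (x i = 0 \<or> x i = X)"
      using pos[OF i] nm[OF i] mq[OF i] xX[OF i] by auto
    also have "q i = x i \<longleftrightarrow> in_tree (V i)"
      using tree[OF i] N1[OF i] by (auto simp: x_def)
    finally show ?thesis .
  qed
  have "int E = B \<longleftrightarrow> (\<forall>i\<in>{1..r}. t i = 0)"
    using sum_nonneg_eq_0_iff[of "{1..r}" t] t0 by (simp add: excess)
  also have "\<dots> \<longleftrightarrow> (\<forall>i\<in>{1..r}. in_tree (V i)) \<and> (\<forall>i\<in>{1..r}. x i = 0 \<or> x i = X)"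
    using t_eq by auto
  also have "(\<forall>i\<in>{1..r}. x i = 0 \<or> x i = X) \<longleftrightarrow> x 1 = X \<and> (\<forall>i\<in>{2..r}. x i = 0)"
    using all_zero_or_sum_iff[of r x, unfolded sumx] assms(1,8) by (simp add: x_def diff_le_mono)
  also have "\<dots> \<longleftrightarrow> N 1 = n - r + 1 \<and> (\<forall>i\<in>{2..r}. N i = 1)"
  proof -
    have "x i = k \<longleftrightarrow> N i = k + 1" if "i \<in> {1..r}" for i k
      using N1[OF that] by (auto simp: x_def)
    then show ?thesis
      using assms(1) by (auto simp: X_def)
  qed
  finally have eq: "int E = B \<longleftrightarrow>
      (\<forall>i\<in>{1..r}. in_tree (V i)) \<and> N 1 = n - r + 1 \<and> (\<forall>i\<in>{2..r}. N i = 1)" .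
  have B: "real_of_int B = (real r - 1) * (real n)\<^sup>2 + (real r)\<^sup>2 * real n - (real r)^3"
    by (simp add: B_def)
  have "B \<le> int E"
    using sum_nonneg[of "{1..r}" t] t0 by (simp add: excess)
  then have "real_of_int B \<le> real E"
    by linarith
  moreover have "laplacian_energy vs G = complex_of_real (real_of_int B) \<longleftrightarrow> int E = B"
    unfolding energy by (metis of_int_eq_iff of_int_of_nat_eq of_real_of_int_eq)
  ultimately show ?thesis
    unfolding B[symmetric] eq[symmetric] by (simp add: energy)
qed

end
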